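(* Let $L$ be a $BL$-algebra and $F:L\to[0,1]$ a fuzzy set. Then $F$ is an $(\overline{\in},\overline{\in}\vee\overline{q})$-fuzzy fantastic filter of $L$ if and only if for every $t\in(0.5,1]$ for which $U(F;t)=\{x\in L\mid F(x)\ge t\}$ is non-empty, $U(F;t)$ is a fantastic filter of $L$.
   Context: A $BL$-algebra is an algebra $(L,\le,\wedge,\vee,\odot,\rightarrow,0,1)$ that is a bounded lattice (least element $0$, greatest element $1$) such that $(L,\odot,1)$ is a commutative monoid, $z\le x\rightarrow y$ iff $x\odot z\le y$, $x\wedge y=x\odot(x\rightarrow y)$, and $(x\rightarrow y)\vee(y\rightarrow x)=1$, for all $x,y,z\in L$. A filter of $L$ is a non-empty subset $A\subseteq L$ with $1\in A$ such that $x\in A$ and $x\rightarrow y\in A$ imply $y\in A$; it is fantastic if $z\rightarrow(y\rightarrow x)\in A$ and $z\in A$ imply $((x\rightarrow y)\rightarrow y)\rightarrow x\in A$ for all $x,y,z$. For $x\in L$ and $t\in(0,1]$, the fuzzy point $U(x;t)$ is said to belong to $F$, written $U(x;t)\in F$, if $F(x)\ge t$, and to be quasi-coincident with $F$, written $U(x;t)\,q\,F$, if $F(x)+t>1$; $\overline{\in}$ and $\overline{q}$ denote the negations of these relations, and $U(x;t)\,\overline{\in}\vee\overline{q}\,F$ means $U(x;t)\,\overline{\in}\,F$ or $U(x;t)\,\overline{q}\,F$. A fuzzy set $F$ is an $(\overline{\in},\overline{\in}\vee\overline{q})$-fuzzy filter of $L$ if for all $t,r\in(0,1]$ and $x,y\in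 L$: (i) if $U(x\odot y;\min\{t,r\})\,\overline{\in}\,F$ then $U(x;t)\,\overline{\in}\vee\overline{q}\,F$ or $U(y;r)\,\overline{\in}\vee\overline{q}\,F$; (ii) if $x\le y$ and $U(y;r)\,\overline{\in}\,F$ then $U(x;r)\,\overline{\in}\vee\overline{q}\,F$. It is an $(\overline{\in},\overline{\in}\vee\overline{q})$-fuzzy fantastic filter if moreover $\max\{F(((x\rightarrow y)\rightarrow y)\rightarrow x),0.5\}\ge\min\{F(z\rightarrow(y\rightarrow x)),F(z)\}$ for all $x,y,z\in L$. *)

theory Defs
  imports Complex_Main
begin

text \<open>The lattice bounds \<open>0\<close> and \<open>1\<close> of the algebra are \<^const>\<open>bot\<close> and \<^const>\<open>top\<close>.\<close>

class bl_algebra = bounded_lattice +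
  fixes odot :: "'a \<Rightarrow> 'a \<Rightarrow> 'a"  (infixl "\<odot>" 72)
    and residuum :: "'a \<Rightarrow> 'a \<Rightarrow> 'a"  (infixr "\<rightarrow>" 71)
  assumes comm_monoid_odot: "comm_monoid (\<odot>) top"
    and residuation: "z \<le> x \<rightarrow> y \<longleftrightarrow> x \<odot> z \<le> y"
    and divisibility: "inf x y = x \<odot> (x \<rightarrow> y)"
    and prelinearity: "sup (x \<rightarrow> y) (y \<rightarrow> x) = top"

definition bl_filter :: "'a::bl_algebra set \<Rightarrow> bool" where
  "bl_filter A \<longleftrightarrow> A \<noteq> {} \<and> top \<in> A \<and> (\<forall>x y. x \<in> A \<longrightarrow> x \<rightarrow> y \<in> A \<longrightarrow> y \<in> A)"

definition fantastic_filter :: "'a::bl_algebra set \<Rightarrow> bool" where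
  "fantastic_filter A \<longleftrightarrow> bl_filter A \<and>
    (\<forall>x y z. z \<rightarrow> (y \<rightarrow> x) \<in> A \<longrightarrow> z \<in> A \<longrightarrow> ((x \<rightarrow> y) \<rightarrow> y) \<rightarrow> x \<in> A)"

definition fuzzy_set :: "('a \<Rightarrow> real) \<Rightarrow> bool" where
  "fuzzy_set F \<longleftrightarrow> (\<forall>x. 0 \<le> F x \<and> F x \<le> 1)"

text \<open>A fuzzy point \<open>U(x;t)\<close> is represented by the two arguments \<open>x\<close> and \<open>t\<close>; the range
  \<open>t \<in> (0,1]\<close> is imposed where fuzzy points are quantified over.\<close>

definition point_belongs :: "'a \<Rightarrow> real \<Rightarrow> ('a \<Rightarrow> real) \<Rightarrow> bool" where
  "point_belongs x t F \<longleftrightarrow> F x \<ge> t"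

definition point_quasi_coincident :: "'a \<Rightarrow> real \<Rightarrow> ('a \<Rightarrow> real) \<Rightarrow> bool" where
  "point_quasi_coincident x t F \<longleftrightarrow> F x + t > 1"

text \<open>The bar of the relation \<open>\<in>\<or>q\<close> is distributed over the two disjuncts: this is the disjunction
  of the negations, not the negation of the disjunction.\<close>

definition point_not_belongs_or_not_quasi :: "'a \<Rightarrow> real \<Rightarrow> ('a \<Rightarrow> real) \<Rightarrow> bool" where
  "point_not_belongs_or_not_quasi x t F \<longleftrightarrow>
    \<not> point_belongs x t F \<or> \<not> point_quasi_coincident x t F"

definition not_in_not_in_or_not_q_fuzzy_filter :: "('a::bl_algebra \<Rightarrow> real) \<Rightarrow> bool" where
  "not_in_not_in_or_not_q_fuzzy_filter F \<longleftrightarrow>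
    (\<forall>t\<in>{0<..1}. \<forall>r\<in>{0<..1}. \<forall>x y.
      \<not> point_belongs (x \<odot> y) (min t r) F \<longrightarrow>
      point_not_belongs_or_not_quasi x t F \<or> point_not_belongs_or_not_quasi y r F) \<and>
    (\<forall>r\<in>{0<..1}. \<forall>x y. x \<le> y \<longrightarrow> \<not> point_belongs y r F \<longrightarrow>
      point_not_belongs_or_not_quasi x r F)"

definition not_in_not_in_or_not_q_fuzzy_fantastic_filter :: "('a::bl_algebra \<Rightarrow> real) \<Rightarrow> bool" where
  "not_in_not_in_or_not_q_fuzzy_fantastic_filter F \<longleftrightarrow> not_in_not_in_or_not_q_fuzzy_filter F \<and>
    (\<forall>x y z. max (F (((x \<rightarrow> y) \<rightarrow> y) \<rightarrow> x)) (1/2) \<ge> min (F (z \<rightarrow> (y \<rightarrow> x))) (F z))"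

definition level_set :: "('a \<Rightarrow> real) \<Rightarrow> real \<Rightarrow> 'a set" where
  "level_set F t = {x. F x \<ge> t}"

end

theory Submission
  imports Defs
begin

text \<open>Each of the three conditions on \<open>F\<close> is equivalent to an inequality of the form
  \<open>min a b \<le> max c (1/2)\<close> between values of \<open>F\<close>, and such an inequality says exactly that every
  threshold \<open>t \<in> (1/2, 1]\<close> below \<open>a\<close> and \<open>b\<close> lies below \<open>c\<close>. The conditions on \<open>F\<close> thus become
  closure conditions on the level sets; a non-empty set is a filter iff it is closed under
  \<open>\<odot>\<close> and upward closed.\<close>

lemma odot_commute: "x \<odot> y = y \<odot> (x::'a::bl_algebra)"
proof -
  interpret comm_monoid "(\<odot>) :: 'a \<Rightarrow> 'a \<Rightarrow> 'a" top by (rule comm_monoid_odot)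
  show ?thesis by (rule commute)
qed

lemma odot_top [simp]: "x \<odot> top = (x::'a::bl_algebra)"
proof -
  interpret comm_monoid "(\<odot>) :: 'a \<Rightarrow> 'a \<Rightarrow> 'a" top by (rule comm_monoid_odot)
  show ?thesis by (rule comm_neutral)
qed

lemma residuum_eq_top_iff: "x \<rightarrow> y = top \<longleftrightarrow> x \<le> (y::'a::bl_algebra)"
  using residuation[of top x y] by (simp add: top_unique)

text \<open>Upward closure comes from detachment since \<open>x \<le> y\<close> makes
  \<open>x \<rightarrow> y\<close> equal to \<open>top\<close>; closure under \<open>\<odot>\<close>
  then follows from \<open>y \<le> x \<rightarrow> (x \<odot> y)\<close>, an instance of
  residuation. Conversely, divisibility turns \<open>x \<odot> (x \<rightarrow> y)\<close> into
  \<open>inf x y\<close>, which lies below \<open>y\<close>.\<close>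

lemma bl_filter_iff_odot_closed_upward_closed:
  "bl_filter (A::'a::bl_algebra set) \<longleftrightarrow>
    A \<noteq> {} \<and> (\<forall>x y. x \<in> A \<longrightarrow> y \<in> A \<longrightarrow> x \<odot> y \<in> A) \<and> (\<forall>x y. x \<le> y \<longrightarrow> x \<in> A \<longrightarrow> y \<in> A)"
proof
  assume A: "bl_filter A"
  have up: "y \<in> A" if "x \<le> y" "x \<in> A" for x y
    using A that unfolding bl_filter_def by (metis residuum_eq_top_iff)
  have "x \<odot> y \<in> A" if "x \<in> A" "y \<in> A" for x y
  proof -
    have "y \<le> x \<rightarrow> (x \<odot> y)"
      by (simp add: residuation)
    then have "x \<rightarrow> (x \<odot> y) \<in> A"
      using up that by blast
    then show ?thesis
      using A that unfolding bl_filter_def by blast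
  qed
  with A up show "A \<noteq> {} \<and> (\<forall>x y. x \<in> A \<longrightarrow> y \<in> A \<longrightarrow> x \<odot> y \<in> A) \<and>
      (\<forall>x y. x \<le> y \<longrightarrow> x \<in> A \<longrightarrow> y \<in> A)"
    unfolding bl_filter_def by blast
next
  assume A: "A \<noteq> {} \<and> (\<forall>x y. x \<in> A \<longrightarrow> y \<in> A \<longrightarrow> x \<odot> y \<in> A) \<and>
      (\<forall>x y. x \<le> y \<longrightarrow> x \<in> A \<longrightarrow> y \<in> A)"
  have "y \<in> A" if "x \<in> A" "x \<rightarrow> y \<in> A" for x y
  proof -
    have "x \<odot> (x \<rightarrow> y) \<le> y"
      by (simp flip: divisibility)
    with A that show ?thesis by blast
  qed
  moreover have "top \<in> A"
    using A top_greatest by blast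
  ultimately show "bl_filter A"
    using A unfolding bl_filter_def by blast
qed

lemma min_le_max_half_iff:
  fixes a b c :: real
  assumes "a \<le> 1"
  shows "min a b \<le> max c (1/2) \<longleftrightarrow> (\<forall>t\<in>{1/2<..1}. t \<le> a \<longrightarrow> t \<le> b \<longrightarrow> t \<le> c)"
proof
  assume "\<forall>t\<in>{1/2<..1}. t \<le> a \<longrightarrow> t \<le> b \<longrightarrow> t \<le> c"
  \<comment> \<open>The largest threshold below both \<open>a\<close> and \<open>b\<close> suffices.
    It is at most 1 because \<open>a \<le> 1\<close>; if it does not exceed 1/2, the goal is
    immediate.\<close>
  from this[rule_format, of "min a b"] assms show "min a b \<le> max c (1/2)"
    by (cases "min a b > 1/2") auto
qed auto

text \<open>The constant 1/2 arises from combining \<open>t \<le> F x\<close> with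
  \<open>F x + t > 1\<close>: together they force \<open>F x > 1/2\<close>, and for
  \<open>t = F x\<close> they amount to exactly that.\<close>

lemma not_in_not_in_or_not_q_fuzzy_filter_iff:
  fixes F :: "'a::bl_algebra \<Rightarrow> real"
  assumes "fuzzy_set F"
  shows "not_in_not_in_or_not_q_fuzzy_filter F \<longleftrightarrow>
    (\<forall>x y. min (F x) (F y) \<le> max (F (x \<odot> y)) (1/2)) \<and>
    (\<forall>x y. x \<le> y \<longrightarrow> F x \<le> max (F y) (1/2))"
proof
  assume F: "not_in_not_in_or_not_q_fuzzy_filter F"
  have le1: "F x \<le> 1" for x
    using assms by (simp add: fuzzy_set_def)
  have "min (F x) (F y) \<le> max (F (x \<odot> y)) (1/2)" for x y
  proof (rule ccontr)
    assume "\<not> ?thesis"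
    then have gt: "1/2 < min (F x) (F y)" "F (x \<odot> y) < min (F x) (F y)"
      by auto
    \<comment> \<open>Both points are taken at the common height \<open>min (F x) (F y)\<close>.
      Each belongs to \<open>F\<close>, and since this height and both values exceed 1/2, each is
      also quasi-coincident with \<open>F\<close>.\<close>
    have mem: "min (F x) (F y) \<in> {0<..1}"
      using gt le1[of x] by auto
    have "\<not> point_belongs (x \<odot> y) (min (min (F x) (F y)) (min (F x) (F y))) F"
      using gt by (auto simp: point_belongs_def)
    then have "point_not_belongs_or_not_quasi x (min (F x) (F y)) F \<or>
        point_not_belongs_or_not_quasi y (min (F x) (F y)) F"
      using F mem unfolding not_in_not_in_or_not_q_fuzzy_filter_def by blast
    with gt show False
      by (auto simp: point_not_belongs_or_not_quasi_def point_belongs_def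
          point_quasi_coincident_def min_def split: if_splits)
  qed
  moreover have "F x \<le> max (F y) (1/2)" if "x \<le> y" for x y
  proof (rule ccontr)
    assume "\<not> ?thesis"
    then have gt: "1/2 < F x" "F y < F x"
      by auto
    have mem: "F x \<in> {0<..1}"
      using gt le1[of x] by auto
    have "\<not> point_belongs y (F x) F"
      using gt by (simp add: point_belongs_def)
    then have "point_not_belongs_or_not_quasi x (F x) F"
      using F mem \<open>x \<le> y\<close> unfolding not_in_not_in_or_not_q_fuzzy_filter_def by blast
    with gt show False
      by (simp add: point_not_belongs_or_not_quasi_def point_belongs_def
          point_quasi_coincident_def)
  qed
  ultimately show "(\<forall>x y. min (F x) (F y) \<le> max (F (x \<odot> y)) (1/2)) \<and>
      (\<forall>x y. x \<le> y \<longrightarrow> F x \<le> max (F y) (1/2))"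
    by blast
next
  assume F: "(\<forall>x y. min (F x) (F y) \<le> max (F (x \<odot> y)) (1/2)) \<and>
      (\<forall>x y. x \<le> y \<longrightarrow> F x \<le> max (F y) (1/2))"
  \<comment> \<open>Here \<open>1 < F x + t \<le> 2 * F x\<close>.\<close>
  have half: "1/2 < F x \<and> t \<le> F x" if "\<not> point_not_belongs_or_not_quasi x t F" for x t
    using that by (auto simp: point_not_belongs_or_not_quasi_def point_belongs_def
        point_quasi_coincident_def)
  have "point_not_belongs_or_not_quasi x t F \<or> point_not_belongs_or_not_quasi y r F"
    if "\<not> point_belongs (x \<odot> y) (min t r) F" for x y t r
  proof (rule ccontr)
    assume "\<not> ?thesis"
    then have "1/2 < F x" "t \<le> F x" "1/2 < F y" "r \<le> F y"
      using half by blast+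
    \<comment> \<open>As the left side exceeds 1/2, the maximum must be
      \<open>F (x \<odot> y)\<close>, so \<open>min t r \<le> F (x \<odot> y)\<close>.\<close>
    moreover have "min (F x) (F y) \<le> max (F (x \<odot> y)) (1/2)"
      using F by blast
    ultimately show False
      using that by (auto simp: point_belongs_def min_def max_def split: if_splits)
  qed
  moreover have "point_not_belongs_or_not_quasi x r F"
    if "x \<le> y" "\<not> point_belongs y r F" for x y r
  proof (rule ccontr)
    assume "\<not> ?thesis"
    then have "1/2 < F x" "r \<le> F x"
      using half by blast+
    moreover have "F x \<le> max (F y) (1/2)"
      using F that by blast
    ultimately show False
      using that by (auto simp: point_belongs_def)
  qed
  ultimately show "not_in_not_in_or_not_q_fuzzy_filter F"
    unfolding not_in_not_in_or_not_q_fuzzy_filter_def by blast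
qed

theorem theorem3p3p4:
  fixes F :: "'a::bl_algebra \<Rightarrow> real"
  assumes "fuzzy_set F"
  shows "not_in_not_in_or_not_q_fuzzy_fantastic_filter F \<longleftrightarrow>
    (\<forall>t\<in>{1/2<..1}. level_set F t \<noteq> {} \<longrightarrow> fantastic_filter (level_set F t))"
proof -
  have min_iff: "min (F x) (F y) \<le> max (F z) (1/2) \<longleftrightarrow>
      (\<forall>t\<in>{1/2<..1}. x \<in> level_set F t \<longrightarrow> y \<in> level_set F t \<longrightarrow> z \<in> level_set F t)" for x y z
    using assms by (simp add: fuzzy_set_def level_set_def min_le_max_half_iff)
  have le_iff: "F x \<le> max (F z) (1/2) \<longleftrightarrow>
      (\<forall>t\<in>{1/2<..1}. x \<in> level_set F t \<longrightarrow> z \<in> level_set F t)" for x z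
    using min_iff[of x x z] by simp
  \<comment> \<open>The guard \<open>A \<noteq> {}\<close> disappears because the empty set
    satisfies all three closure conditions vacuously.\<close>
  have fantastic_iff: "(A \<noteq> {} \<longrightarrow> fantastic_filter A) \<longleftrightarrow>
      (\<forall>x y. x \<in> A \<longrightarrow> y \<in> A \<longrightarrow> x \<odot> y \<in> A) \<and>
      (\<forall>x y. x \<le> y \<longrightarrow> x \<in> A \<longrightarrow> y \<in> A) \<and>
      (\<forall>x y z. z \<rightarrow> (y \<rightarrow> x) \<in> A \<longrightarrow> z \<in> A \<longrightarrow> ((x \<rightarrow> y) \<rightarrow> y) \<rightarrow> x \<in> A)"
    for A :: "'a set"
    by (cases "A = {}")
      (simp_all add: fantastic_filter_def bl_filter_iff_odot_closed_upward_closed)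
  show ?thesis
    \<comment> \<open>After rewriting, the two sides differ only in the order of the quantifiers
      over thresholds and elements, and in how these distribute over the conjunction.\<close>
    unfolding not_in_not_in_or_not_q_fuzzy_fantastic_filter_def
      not_in_not_in_or_not_q_fuzzy_filter_iff[OF assms] min_iff le_iff fantastic_iff
    by meson
qed

end
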